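(* Let $\kappa$ be a regular cardinal and $\lambda > \kappa$ a cardinal. Then $\mathfrak{d}^\lambda_\kappa \geq \mathfrak{d}^\lambda_{\kappa^+}$.
   Context: For a regular cardinal $\mu\le\lambda$ and $f,g\in\mu^\lambda$, $f\leq^* g$ means $|\{\gamma<\lambda : f(\gamma)>g(\gamma)\}|<\mu$. $\mathfrak{d}^\lambda_\mu$ is the least size of a family $F\subseteq\mu^\lambda$ such that every $g\in\mu^\lambda$ satisfies $g\leq^* f$ for some $f\in F$. *)

theory Defs
  imports Main
begin

unbundle cardinal_syntax

text \<open>
  Cardinals are represented, as in the library, by well-order relations \<open>r\<close> with
  \<open>Card_order r\<close> (each minimal among the well-orders of its field).  The field of \<open>r\<close>
  plays the role of the initial ordinal, \<open>(x, y) \<in> r\<close> is the non-strict order on it, and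
  \<open>Func (Field l) (Field m)\<close> is the set of functions from \<open>l\<close> to \<open>m\<close>
  (normalised to \<open>undefined\<close> outside \<open>Field l\<close>, so that distinct elements are distinct
  functions on \<open>Field l\<close>).  Cardinals on different types are compared by \<open>\<le>o\<close>, \<open><o\<close>, \<open>=o\<close>.
\<close>

text \<open>\<open>f \<le>\<^sup>* g\<close>, for functions from \<open>l\<close> to \<open>m\<close>: fewer than \<open>m\<close> arguments \<open>x\<close> have \<open>f x > g x\<close>.\<close>

definition le_star :: "'l rel \<Rightarrow> 'm rel \<Rightarrow> ('l \<Rightarrow> 'm) \<Rightarrow> ('l \<Rightarrow> 'm) \<Rightarrow> bool" where
  "le_star l m f g \<longleftrightarrow> |{x \<in> Field l. (g x, f x) \<in> m \<and> g x \<noteq> f x}| <o m"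

definition dominating_family :: "'l rel \<Rightarrow> 'm rel \<Rightarrow> ('l \<Rightarrow> 'm) set \<Rightarrow> bool" where
  "dominating_family l m F \<longleftrightarrow>
     F \<subseteq> Func (Field l) (Field m) \<and>
     (\<forall>g \<in> Func (Field l) (Field m). \<exists>f \<in> F. le_star l m g f)"

text \<open>
  The number \<open>\<dd>\<^sup>l\<^sub>m\<close> is the least cardinality of a dominating family.  The choice of the family
  attaining it affects the value only up to \<open>=o\<close>; such a family exists by
  \<open>ex_least_dominating_family\<close> below.
\<close>

definition dominating_number :: "'l rel \<Rightarrow> 'm rel \<Rightarrow> ('l \<Rightarrow> 'm) rel" where
  "dominating_number l m =
     |SOME F. dominating_family l m F \<and> (\<forall>G. dominating_family l m G \<longrightarrow> |F| \<le>o |G| )|"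

lemma dominating_family_Func:
  fixes l :: "'l rel" and m :: "'m rel"
  assumes "Cinfinite m"
  shows "dominating_family l m (Func (Field l) (Field m))"
proof -
  have "Cfinite |{} :: 'l set|"
    unfolding cfinite_def using card_of_Card_order by (metis Field_card_of finite.emptyI)
  then have "|{} :: 'l set| <o m"
    using assms by (rule Cfinite_ordLess_Cinfinite)
  moreover have "{x \<in> Field l. (g x, g x) \<in> m \<and> g x \<noteq> g x} = {}" for g :: "'l \<Rightarrow> 'm"
    by simp
  ultimately have "le_star l m g g" for g
    unfolding le_star_def by metis
  then show ?thesis
    unfolding dominating_family_def by blast
qed

lemma ex_least_dominating_family:
  assumes "Cinfinite m"
  shows "\<exists>F. dominating_family l m F \<and> (\<forall>G. dominating_family l m G \<longrightarrow> |F| \<le>o |G| )"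
proof -
  let ?R = "card_of ` Collect (dominating_family l m)"
  have "?R \<noteq> {}"
    using dominating_family_Func[OF assms, of l] by blast
  moreover have "\<forall>r \<in> ?R. Card_order r"
    using card_of_Card_order by blast
  ultimately have "\<exists>r \<in> ?R. \<forall>r' \<in> ?R. r \<le>o r'"
    by (rule exists_minim_Card_order)
  then show ?thesis
    by blast
qed

lemma dominating_number_least:
  assumes "Cinfinite m"
  shows "\<exists>F. dominating_family l m F \<and> |F| =o dominating_number l m"
    and "dominating_family l m G \<Longrightarrow> dominating_number l m \<le>o |G|"
  using someI_ex[OF ex_least_dominating_family[OF assms, of l]]
  unfolding dominating_number_def by (auto intro: card_of_refl)

end

theory Submission
  imports Defs
begin

text \<open>
  Write \<open>\<kappa>\<close>, \<open>\<lambda>\<close> for the two cardinals, and fix injections \<open>e \<beta> : \<beta> \<rightarrow> \<kappa>\<close> for \<open>\<beta> < \<kappa>\<^sup>+\<close>.  Since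
  \<open>\<kappa>\<^sup>+ \<le> \<lambda>\<close>, functions \<open>\<lambda> \<times> \<kappa>\<^sup>+ \<rightarrow> \<kappa>\<close> may be regarded as functions \<open>\<lambda> \<rightarrow> \<kappa>\<close>.  A function
  \<open>g : \<lambda> \<rightarrow> \<kappa>\<^sup>+\<close> is encoded by \<open>(\<gamma>, \<beta>) \<mapsto> e \<beta> (g \<gamma>)\<close>, for \<open>g \<gamma> < \<beta>\<close>.  If \<open>f\<close> dominates this code,
  then \<open>g \<gamma>\<close> belongs, for every \<open>\<gamma>\<close>, to the set \<open>S\<close> of all \<open>\<xi>\<close> such that \<open>e \<beta> \<xi> \<le> f (\<gamma>, \<beta>)\<close> for all
  but fewer than \<open>\<kappa>\<close> of the \<open>\<beta> > \<xi>\<close>.  This set has fewer than \<open>\<kappa>\<close> elements: otherwise take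
  \<open>T \<subseteq> S\<close> of size \<open>\<kappa>\<close> and \<open>\<beta>\<close> above \<open>T\<close> which is exceptional for no element of \<open>T\<close>; then \<open>e \<beta>\<close> maps
  \<open>T\<close> injectively into the elements of \<open>\<kappa>\<close> below \<open>f (\<gamma>, \<beta>)\<close>.  So \<open>S\<close> has a bound in \<open>\<kappa>\<^sup>+\<close>, which
  depends on \<open>f\<close> and \<open>\<gamma>\<close> only, and these bounds dominate \<open>g\<close> everywhere.
\<close>

lemma Cinfinite_card_of_under:
  assumes "Cinfinite r"
  shows "|under r a| <o r"
proof -
  have fin: "|B| <o r" if "finite B" for B :: "'a set"
    using that assms Cfinite_ordLess_Cinfinite[of "|B|" r]
    by (simp add: cfinite_def card_of_card_order_on Field_card_of)
  show ?thesis
  proof (cases "a \<in> Field r")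
    case True
    have "|underS r a \<union> {a}| <o r"
      using assms card_of_underS[OF _ True] fin[of "{a}"]
      by (intro card_of_Un_ordLess_infinite_Field) (auto simp: cinfinite_def)
    moreover have "under r a \<subseteq> underS r a \<union> {a}"
      by (auto simp: under_def underS_def)
    ultimately show ?thesis
      using card_of_mono1 ordLeq_ordLess_trans by blast
  next
    case False
    then have "under r a = {}"
      by (auto simp: under_def Field_def)
    then show ?thesis
      using fin by simp
  qed
qed

text \<open>The initial segments up to the elements of \<open>A\<close>, together with
  \<open>B\<close>, have at most \<open>k\<close> elements in all, too few to exhaust
  \<open>cardSuc k\<close>. By totality, any point left over lies above all of
  \<open>A\<close>.\<close>

lemma cardSuc_ex_upper_bound_avoiding:
  fixes k :: "'k rel" and A B :: "'k set set"
  assumes k: "Cinfinite k" and A: "|A| \<le>o k" "A \<subseteq> Field (cardSuc k)" and B: "|B| \<le>o k"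
  shows "\<exists>b \<in> Field (cardSuc k) - B. A \<subseteq> underS (cardSuc k) b"
proof -
  let ?s = "cardSuc k"
  have s: "Cinfinite ?s"
    using k by (rule Cinfinite_cardSuc)
  have inf: "\<not> finite (Field k)"
    using k by (simp add: cinfinite_def)
  have "\<forall>a\<in>A. |under ?s a| \<le>o k"
  proof
    fix a assume "a \<in> A"
    have "|under ?s a| <o ?s"
      using s by (rule Cinfinite_card_of_under)
    then show "|under ?s a| \<le>o k"
      using cardSuc_ordLeq_ordLess[of k "|under ?s a|"] k card_of_Card_order by blast
  qed
  then have "|\<Union>a\<in>A. under ?s a| \<le>o k"
    using inf k A(1) by (intro card_of_UNION_ordLeq_infinite_Field) auto
  then have small: "|(\<Union>a\<in>A. under ?s a) \<union> B| \<le>o k"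
    using inf k B by (intro card_of_Un_ordLeq_infinite_Field) auto
  have "\<not> Field ?s \<subseteq> (\<Union>a\<in>A. under ?s a) \<union> B"
  proof
    assume "Field ?s \<subseteq> (\<Union>a\<in>A. under ?s a) \<union> B"
    then have "|Field ?s| \<le>o k"
      using card_of_mono1 small ordLeq_transitive by blast
    moreover have "?s =o |Field ?s|"
      using s by (intro ordIso_symmetric[OF card_of_Field_ordIso]) simp
    ultimately have "?s \<le>o k"
      by (rule ordIso_ordLeq_trans[rotated])
    moreover have "k <o ?s"
      using k by (intro cardSuc_greater) simp
    ultimately show False
      using not_ordLess_ordLeq by blast
  qed
  then obtain b where b: "b \<in> Field ?s" "b \<notin> B" "\<forall>a\<in>A. (b, a) \<notin> ?s"
    by (auto simp: under_def)
  have "a \<in> underS ?s b" if "a \<in> A" for a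
  proof -
    have "wo_rel ?s"
      using s by (simp add: wo_rel_def card_order_on_def)
    moreover have "a \<in> Field ?s"
      using that A(2) by blast
    ultimately show ?thesis
      using b that wo_rel.TOTALS[of ?s] unfolding underS_def by blast
  qed
  with b show ?thesis
    by blast
qed

lemma card_of_almost_bounded_codes:
  fixes k :: "'k rel" and e :: "'k set \<Rightarrow> 'k set \<Rightarrow> 'k"
  assumes k: "Cinfinite k"
    and inj: "\<And>b. b \<in> Field (cardSuc k) \<Longrightarrow> inj_on (e b) (underS (cardSuc k) b)"
    and e: "\<And>b. b \<in> Field (cardSuc k) \<Longrightarrow> e b ` underS (cardSuc k) b \<subseteq> Field k"
    and c: "\<And>b. b \<in> Field (cardSuc k) \<Longrightarrow> c b \<in> Field k"
  shows "|{x \<in> Field (cardSuc k). |{b \<in> Field (cardSuc k).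
            x \<in> underS (cardSuc k) b \<and> (c b, e b x) \<in> k \<and> c b \<noteq> e b x}| <o k}| <o k"
    (is "|?S| <o k")
proof (rule ccontr)
  define E where "E x = {b \<in> Field (cardSuc k).
    x \<in> underS (cardSuc k) b \<and> (c b, e b x) \<in> k \<and> c b \<noteq> e b x}" for x
  assume "\<not> |?S| <o k"
  then have "k \<le>o |?S|"
    using k card_of_Well_order[of ?S] not_ordLess_iff_ordLeq[of k "|?S|"]
    by (simp add: card_order_on_def)
  then have "|Field k| \<le>o |?S|"
    using k card_of_Field_ordIso ordIso_ordLeq_trans by blast
  then obtain T where T: "T \<subseteq> ?S" "|Field k| =o |T|"
    using internalize_card_of_ordLeq2[of "Field k" ?S] by blast
  have Tk: "|T| =o k"
    using T(2) k card_of_Field_ordIso ordIso_symmetric ordIso_transitive by blast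
  \<comment> \<open>\<open>T\<close> has size \<open>k\<close>, and every \<open>E x\<close> is
    small because \<open>x\<close> lies in the set being bounded; so all exceptional points together
    can be avoided at once.\<close>
  have "|\<Union>x\<in>T. E x| \<le>o k"
  proof (rule card_of_UNION_ordLeq_infinite_Field)
    show "\<forall>x\<in>T. |E x| \<le>o k"
      using T(1) ordLess_imp_ordLeq unfolding E_def by blast
  qed (use k Tk in \<open>auto simp: cinfinite_def ordIso_iff_ordLeq\<close>)
  moreover have "|T| \<le>o k"
    using Tk ordIso_imp_ordLeq by blast
  ultimately obtain b where b: "b \<in> Field (cardSuc k)" "b \<notin> (\<Union>x\<in>T. E x)"
    and T_b: "T \<subseteq> underS (cardSuc k) b"
    using cardSuc_ex_upper_bound_avoiding[OF k, of T "\<Union>x\<in>T. E x"] T(1) by blast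
  have "wo_rel k"
    using k by (simp add: wo_rel_def card_order_on_def)
  have "e b x \<in> under k (c b)" if "x \<in> T" for x
  proof -
    have x: "x \<in> underS (cardSuc k) b"
      using that T_b by blast
    then have "e b x \<in> Field k"
      using e b(1) by blast
    moreover have "(c b, e b x) \<notin> k \<or> c b = e b x"
      using b that x unfolding E_def by blast
    ultimately show ?thesis
      using c[OF b(1)] wo_rel.TOTALS[OF \<open>wo_rel k\<close>] unfolding under_def by (metis mem_Collect_eq)
  qed
  moreover have "inj_on (e b) T"
    using inj[OF b(1)] T_b inj_on_subset by blast
  ultimately have "|T| \<le>o |under k (c b)|"
    using card_of_ordLeq[of T "under k (c b)"] by blast
  then have "|T| <o k"
    using Cinfinite_card_of_under[OF k] ordLeq_ordLess_trans by blast
  then show False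
    using Tk not_ordLess_ordIso by blast
qed

theorem theorem4p2:
  fixes k :: "'k rel" and l :: "'l rel"
  assumes "Cinfinite k" and "regularCard k"
    and "Card_order l" and "k <o l"
  shows "dominating_number l (cardSuc k) \<le>o dominating_number l k"
proof -
  let ?s = "cardSuc k"
  note k = \<open>Cinfinite k\<close>
  have s: "Cinfinite ?s"
    using k by (rule Cinfinite_cardSuc)
  have "\<exists>h. inj_on h (underS ?s b) \<and> h ` underS ?s b \<subseteq> Field k" if "b \<in> Field ?s" for b
  proof -
    have "|underS ?s b| <o ?s"
      using s that by (intro card_of_underS) simp_all
    then have "|underS ?s b| \<le>o k"
      using cardSuc_ordLeq_ordLess[of k "|underS ?s b|"] k card_of_Card_order by blast
    then have "|underS ?s b| \<le>o |Field k|"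
      using k card_of_Field_ordIso ordIso_symmetric ordLeq_ordIso_trans by blast
    then show ?thesis
      by (simp add: card_of_ordLeq)
  qed
  then have "\<forall>b\<in>Field ?s. \<exists>h. inj_on h (underS ?s b) \<and> h ` underS ?s b \<subseteq> Field k"
    by blast
  from bchoice[OF this] obtain e
    where inj: "\<And>b. b \<in> Field ?s \<Longrightarrow> inj_on (e b) (underS ?s b)"
      and e: "\<And>b. b \<in> Field ?s \<Longrightarrow> e b ` underS ?s b \<subseteq> Field k"
    by blast
  have sl: "?s \<le>o l"
    using k assms(3,4) by (intro cardSuc_least) auto
  have infl: "\<not> finite (Field l)"
    using s sl cinfinite_mono by (auto simp: cinfinite_def)
  have "|Field ?s| =o ?s"
    using s by (intro card_of_Field_ordIso) simp
  then have "|Field ?s| \<le>o l"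
    using sl by (rule ordIso_ordLeq_trans)
  moreover have "|Field l| \<le>o l"
    using assms(3) card_of_Field_ordIso ordIso_imp_ordLeq by blast
  ultimately have "|Field l \<times> Field ?s| \<le>o l"
    using infl assms(3) by (intro card_of_Times_ordLeq_infinite_Field)
  then have "|Field l \<times> Field ?s| \<le>o |Field l|"
    using assms(3) card_of_Field_ordIso ordIso_symmetric ordLeq_ordIso_trans by blast
  \<comment> \<open>\<open>p\<close> codes pairs as elements of \<open>Field l\<close>; it need not
    be onto.\<close>
  then obtain p where p: "inj_on p (Field l \<times> Field ?s)" "p ` (Field l \<times> Field ?s) \<subseteq> Field l"
    using card_of_ordLeq[of "Field l \<times> Field ?s" "Field l"] by blast

  define S where "S f x = {y \<in> Field ?s. |{b \<in> Field ?s. y \<in> underS ?s b \<and>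
      (f (p (x, b)), e b y) \<in> k \<and> f (p (x, b)) \<noteq> e b y}| <o k}" for f x
  define h where "h f x = (SOME b. b \<in> Field ?s \<and> S f x \<subseteq> underS ?s b)" for f x
  have bound: "\<exists>b \<in> Field ?s. S f x \<subseteq> underS ?s b"
    if "f \<in> Func (Field l) (Field k)" "x \<in> Field l" for f x
  proof -
    have "f (p (x, b)) \<in> Field k" if "b \<in> Field ?s" for b
      using that \<open>x \<in> Field l\<close> \<open>f \<in> _\<close> p(2) by (auto simp: Func_def)
    then have "|S f x| <o k"
      unfolding S_def by (intro card_of_almost_bounded_codes k inj e)
    moreover have "S f x \<subseteq> Field ?s"
      by (auto simp: S_def)
    moreover have "|{} :: 'k set set| \<le>o k"
      using k card_of_empty1[of k] by (simp add: card_order_on_def)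
    ultimately show ?thesis
      using cardSuc_ex_upper_bound_avoiding[OF k, of "S f x" "{}"] ordLess_imp_ordLeq by blast
  qed
  have h: "h f x \<in> Field ?s \<and> S f x \<subseteq> underS ?s (h f x)"
    if "f \<in> Func (Field l) (Field k)" "x \<in> Field l" for f x
    unfolding h_def by (rule someI_ex[OF bound[OF that, unfolded Bex_def]])
  define H where "H f x = (if x \<in> Field l then h f x else undefined)" for f x

  obtain F where F: "dominating_family l k F" "|F| =o dominating_number l k"
    using dominating_number_least(1)[OF k] by blast
  have "dominating_family l ?s (H ` F)"
    unfolding dominating_family_def
  proof (intro conjI ballI)
    show "H ` F \<subseteq> Func (Field l) (Field ?s)"
      using F(1) h by (auto simp: dominating_family_def Func_def H_def)
  next
    fix g assume g: "g \<in> Func (Field l) (Field ?s)"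
    obtain z where z: "z \<in> Field k"
      using k by (force simp: cinfinite_def)
    \<comment> \<open>The default \<open>z\<close> for \<open>b\<close> not above \<open>g x\<close>
      is harmless: only those \<open>b\<close> with \<open>g x\<close> in \<open>underS ?s b\<close>
      are counted in \<open>S\<close>.\<close>
    define code where "code = (\<lambda>(x, b). if g x \<in> underS ?s b then e b (g x) else z)"
    define g' where "g' y = (if y \<notin> Field l then undefined
      else if y \<in> p ` (Field l \<times> Field ?s) then code (inv_into (Field l \<times> Field ?s) p y) else z)"
      for y
    have g'_p: "g' (p (x, b)) = code (x, b)" if "x \<in> Field l" "b \<in> Field ?s" for x b
    proof -
      have "(x, b) \<in> Field l \<times> Field ?s"
        using that by simp
      moreover from this have "p (x, b) \<in> Field l"
        using p(2) by blast
      ultimately show ?thesis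
        using inv_into_f_f[OF p(1)] unfolding g'_def by auto
    qed
    have code_Field: "code (x, b) \<in> Field k" if "b \<in> Field ?s" for x b
      using e[OF that] z by (auto simp: code_def)
    have "g' y \<in> Field k" if "y \<in> Field l" for y
    proof (cases "y \<in> p ` (Field l \<times> Field ?s)")
      case True
      then obtain x b where "x \<in> Field l" "b \<in> Field ?s" "y = p (x, b)"
        by blast
      then show ?thesis
        using g'_p code_Field by simp
    next
      case False
      then show ?thesis
        using that z by (simp add: g'_def)
    qed
    then have "g' \<in> Func (Field l) (Field k)"
      by (auto simp: Func_def g'_def)
    then obtain f where f: "f \<in> F" "le_star l k g' f"
      using F(1) unfolding dominating_family_def by blast
    have fF: "f \<in> Func (Field l) (Field k)"
      using f(1) F(1) unfolding dominating_family_def by blast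
    have "g x \<in> underS ?s (H f x)" if x: "x \<in> Field l" for x
    proof -
      let ?E = "{b \<in> Field ?s. g x \<in> underS ?s b \<and>
        (f (p (x, b)), e b (g x)) \<in> k \<and> f (p (x, b)) \<noteq> e b (g x)}"
      let ?D = "{y \<in> Field l. (f y, g' y) \<in> k \<and> f y \<noteq> g' y}"
      \<comment> \<open>For fixed \<open>x\<close>, exceptional \<open>b\<close> for
        \<open>g x\<close> give distinct places where \<open>g'\<close> exceeds \<open>f\<close>, of
        which there are fewer than \<open>k\<close>.\<close>
      have "inj_on (\<lambda>b. p (x, b)) ?E"
        using p(1) x by (auto simp: inj_on_def)
      moreover have "(\<lambda>b. p (x, b)) ` ?E \<subseteq> ?D"
        using p(2) x g'_p[OF x] by (auto simp: code_def)
      ultimately have "|?E| \<le>o |?D|"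
        using card_of_ordLeq[of ?E ?D] by blast
      then have "|?E| <o k"
        using f(2) ordLeq_ordLess_trans unfolding le_star_def by blast
      moreover have "g x \<in> Field ?s"
        using g x by (auto simp: Func_def)
      ultimately have "g x \<in> S f x"
        by (simp add: S_def)
      then show ?thesis
        using h[OF fF x] x by (auto simp: H_def)
    qed
    moreover have "antisym ?s"
      using s by (simp add: card_order_on_def well_order_on_def linear_order_on_def
          partial_order_on_def)
    \<comment> \<open>\<open>g x\<close> is strictly below \<open>H f x\<close> at every
      \<open>x\<close>, so by antisymmetry no exceptions remain.\<close>
    ultimately have "{x \<in> Field l. (H f x, g x) \<in> ?s \<and> H f x \<noteq> g x} = {}"
      by (auto simp: underS_def dest: antisymD)
    moreover have "|{} :: 'l set| <o ?s"
      using s Cfinite_ordLess_Cinfinite[of "|{} :: 'l set|" ?s]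
      by (simp add: cfinite_def card_of_card_order_on Field_card_of)
    ultimately have "le_star l ?s g (H f)"
      unfolding le_star_def by metis
    then show "\<exists>f\<in>H ` F. le_star l ?s g f"
      using f(1) by blast
  qed
  then have "dominating_number l ?s \<le>o |H ` F|"
    by (rule dominating_number_least(2)[OF s])
  also have "|H ` F| \<le>o |F|"
    by (rule card_of_image)
  also have "|F| =o dominating_number l k"
    by (rule F(2))
  finally show ?thesis .
qed

end
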